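(* Let $R$ be a field of characteristic $0$ (or, more generally, a commutative ring in a setting in which the Homotopy Transfer Theorem holds, i.e. in which the operations $m_n^Y$ described in the context define an $A_\infty$-algebra structure on $Y$). Let $X$ be an $A_\infty$-algebra over $R$ with operations $m_n^X$ for $n\ge1$. Consider a deformation retract of complexes of $R$-modules $$i\colon (Y,\partial^Y)\to (X,\partial^X),\qquad p\colon (X,\partial^X)\to (Y,\partial^Y),$$ with associated homotopy $h$ on $X$, such that $h$ satisfies the generalized Leibniz rule for an $A_\infty$-algebra and $hi=0$. Then the $A_\infty$-algebra structure on $Y$ obtained from the $A_\infty$-algebra structure on $X$ by the Homotopy Transfer Theorem has operations given by $$m_n^Y=p\,m_n^X(i\otimes\cdots\otimes i)$$ for all $n\ge1$.
   Context: Complexes are complexes of $R$-modules, graded homologically. An $A_\infty$-algebra over $R$ is a complex $A$ of $R$-modules with $R$-multilinear maps $m_n\colon A^{\otimes n}\to A$ of degree $n-2$ for $n\ge1$, with $m_1=\partial_A$, satisfying for all $n\ge 1$ the Stasheff identities $\sum (-1)^{r+st}m_{r+1+t}(1^{\otimes r}\otimes m_s\otimes 1^{\otimes t})=0$, summed over $s\ge1$, $r,t\ge0$ with $r+s+t=n$; the Koszul sign rule $(f\otimes g)(x\otimes y)=(-1)^{|g||x|}f(x)\otimes g(y)$ is used throughout. A deformation retract consists of quasi-isomorphisms of complexes $i\colon Y\to X$, $p\colon X\to Y$ and a homotopy $h$ on $X$ (graded $R$-linear of degree $1$) with $ip=1+\partial^Xh+h\partial^X$ and $pi=1$. The homotopy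 $h$ on $X$ satisfies the generalized Leibniz rule for an $A_\infty$-algebra if for every $n\ge2$ and all $a_1,\dots,a_n\in X$, $$h(m_n^X(a_1\otimes\cdots\otimes a_n))\in\sum_{j=1}^n m_n^X(X\otimes\cdots\otimes h(a_j)\otimes\cdots\otimes X),$$ where $h(a_j)$ is the $j$th factor and all other factors are $X$. Homotopy Transfer Theorem for $A_\infty$-algebras: the transferred structure on $Y$ has $m_1^Y=\partial^Y$ and, for $n\ge2$, $$m_n^Y=\sum_{T\in PT_n}\epsilon_T\,m_T,$$ where $PT_n$ is the set of planar rooted trees with $n$ leaves in which every internal vertex has at least two inputs, $\epsilon_T\in\{1,-1\}$ are the signs given by the Homotopy Transfer Theorem (the sign of the tree with a single internal vertex is $+1$; the other values are not needed here), and $m_T\colon Y^{\otimes n}\to Y$ is defined as follows. For the trivial tree (a single leaf) put $\varphi_{|}=i$. If $T$ has at least two leaves and its root vertex has inputs the subtrees $T_1,\dots,T_k$ (from left to right, $k\ge2$), put $\varphi_T=h\,m_k^X(\varphi_{T_1}\otimes\cdots\otimes\varphi_{T_k})$ and $m_T=p\,m_k^X(\varphi_{T_1}\otimes\cdots\otimes\varphi_{T_k})$. In other words, $i$ is applied at each leaf, operations of $X$ at internal vertices, each followed by $h$, except the last one (at the root), which is followed by $p$. *)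

theory Defs
  imports "HOL-Computational_Algebra.Computational_Algebra"
begin

(* A graded module is an R-module, carried by a whole type, that is the internal direct sum of
   the submodules gr d of homogeneous elements of degree d. *)

definition homogeneous_decomposition ::
    "(int \<Rightarrow> 'x set) \<Rightarrow> 'x::ab_group_add \<Rightarrow> (int \<Rightarrow> 'x) \<Rightarrow> bool" where
  "homogeneous_decomposition gr x c \<longleftrightarrow>
     (\<forall>d. c d \<in> gr d) \<and> finite {d. c d \<noteq> 0} \<and> x = (\<Sum>d | c d \<noteq> 0. c d)"

locale graded_module = module scale
  for scale :: "'r::comm_ring_1 \<Rightarrow> 'x::ab_group_add \<Rightarrow> 'x" +
  fixes gr :: "int \<Rightarrow> 'x set"
  assumes subspace_gr: "subspace (gr d)"
    and direct_sum: "\<exists>!c. homogeneous_decomposition gr x c"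

definition component :: "(int \<Rightarrow> 'x set) \<Rightarrow> 'x::ab_group_add \<Rightarrow> int \<Rightarrow> 'x" where
  "component gr x = (THE c. homogeneous_decomposition gr x c)"

definition homogeneous :: "(int \<Rightarrow> 'x set) \<Rightarrow> 'x \<Rightarrow> bool" where
  "homogeneous gr x \<longleftrightarrow> (\<exists>d. x \<in> gr d)"

definition graded_map ::
    "('r::comm_ring_1 \<Rightarrow> 'x::ab_group_add \<Rightarrow> 'x) \<Rightarrow> (int \<Rightarrow> 'x set) \<Rightarrow>
     ('r \<Rightarrow> 'y::ab_group_add \<Rightarrow> 'y) \<Rightarrow> (int \<Rightarrow> 'y set) \<Rightarrow> int \<Rightarrow> ('x \<Rightarrow> 'y) \<Rightarrow> bool" where
  "graded_map sX gX sY gY k f \<longleftrightarrow>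
     module_hom sX sY f \<and> (\<forall>d. \<forall>x\<in>gX d. f x \<in> gY (d + k))"


locale chain_complex = graded_module scale gr
  for scale :: "'r::comm_ring_1 \<Rightarrow> 'x::ab_group_add \<Rightarrow> 'x" and gr :: "int \<Rightarrow> 'x set" +
  fixes bd :: "'x \<Rightarrow> 'x"
  assumes bd_graded: "graded_map scale gr scale gr (-1) bd"
    and bd_bd: "bd (bd x) = 0"

definition chain_map ::
    "('r::comm_ring_1 \<Rightarrow> 'x::ab_group_add \<Rightarrow> 'x) \<Rightarrow> (int \<Rightarrow> 'x set) \<Rightarrow> ('x \<Rightarrow> 'x) \<Rightarrow>
     ('r \<Rightarrow> 'y::ab_group_add \<Rightarrow> 'y) \<Rightarrow> (int \<Rightarrow> 'y set) \<Rightarrow> ('y \<Rightarrow> 'y) \<Rightarrow> ('x \<Rightarrow> 'y) \<Rightarrow> bool" where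
  "chain_map sX gX dX sY gY dY f \<longleftrightarrow>
     graded_map sX gX sY gY 0 f \<and> (\<forall>x. f (dX x) = dY (f x))"

definition cycles :: "(int \<Rightarrow> 'x::ab_group_add set) \<Rightarrow> ('x \<Rightarrow> 'x) \<Rightarrow> int \<Rightarrow> 'x set" where
  "cycles gr bd n = {x \<in> gr n. bd x = 0}"

definition homologous :: "(int \<Rightarrow> 'x::ab_group_add set) \<Rightarrow> ('x \<Rightarrow> 'x) \<Rightarrow> int \<Rightarrow> 'x rel" where
  "homologous gr bd n =
     {(x, y). x \<in> cycles gr bd n \<and> y \<in> cycles gr bd n \<and> x - y \<in> bd ` gr (n + 1)}"

definition homology :: "(int \<Rightarrow> 'x::ab_group_add set) \<Rightarrow> ('x \<Rightarrow> 'x) \<Rightarrow> int \<Rightarrow> 'x set set" where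
  "homology gr bd n = cycles gr bd n // homologous gr bd n"

(* The map induced by f sends the class C to the class of f x for any x in C. *)
definition quasi_isomorphism ::
    "('r::comm_ring_1 \<Rightarrow> 'x::ab_group_add \<Rightarrow> 'x) \<Rightarrow> (int \<Rightarrow> 'x set) \<Rightarrow> ('x \<Rightarrow> 'x) \<Rightarrow>
     ('r \<Rightarrow> 'y::ab_group_add \<Rightarrow> 'y) \<Rightarrow> (int \<Rightarrow> 'y set) \<Rightarrow> ('y \<Rightarrow> 'y) \<Rightarrow> ('x \<Rightarrow> 'y) \<Rightarrow> bool" where
  "quasi_isomorphism sX gX dX sY gY dY f \<longleftrightarrow>
     chain_map sX gX dX sY gY dY f \<and>
     (\<forall>n. bij_betw (\<lambda>C. homologous gY dY n `` (f ` C)) (homology gX dX n) (homology gY dY n))"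

locale deformation_retract =
  X: chain_complex sX gX dX + Y: chain_complex sY gY dY
  for sX :: "'r::comm_ring_1 \<Rightarrow> 'x::ab_group_add \<Rightarrow> 'x" and gX :: "int \<Rightarrow> 'x set"
    and dX :: "'x \<Rightarrow> 'x"
    and sY :: "'r \<Rightarrow> 'y::ab_group_add \<Rightarrow> 'y" and gY :: "int \<Rightarrow> 'y set"
    and dY :: "'y \<Rightarrow> 'y" +
  fixes i :: "'y \<Rightarrow> 'x" and p :: "'x \<Rightarrow> 'y" and h :: "'x \<Rightarrow> 'x"
  assumes i_quasi_isomorphism: "quasi_isomorphism sY gY dY sX gX dX i"
    and p_quasi_isomorphism: "quasi_isomorphism sX gX dX sY gY dY p"
    and h_graded: "graded_map sX gX sX gX 1 h"
    and i_p: "i (p x) = x + dX (h x) + h (dX x)"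
    and p_i: "p (i y) = y"


(* A linear map on an n-fold tensor power is encoded by a multilinear function on lists of
   length n; its values on lists of other lengths are irrelevant. *)

definition multilinear ::
    "('r::comm_ring_1 \<Rightarrow> 'x::ab_group_add \<Rightarrow> 'x) \<Rightarrow> ('r \<Rightarrow> 'y::ab_group_add \<Rightarrow> 'y) \<Rightarrow>
     nat \<Rightarrow> ('x list \<Rightarrow> 'y) \<Rightarrow> bool" where
  "multilinear sX sY n f \<longleftrightarrow>
     (\<forall>xs j. length xs = n \<longrightarrow> j < n \<longrightarrow> module_hom sX sY (\<lambda>x. f (xs[j := x])))"

definition multi_degree :: "(int \<Rightarrow> 'x set) \<Rightarrow> nat \<Rightarrow> int \<Rightarrow> ('x list \<Rightarrow> 'x) \<Rightarrow> bool" where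
  "multi_degree gr n k f \<longleftrightarrow>
     (\<forall>ds xs. length xs = n \<longrightarrow> list_all2 (\<lambda>d x. x \<in> gr d) ds xs \<longrightarrow> f xs \<in> gr (sum_list ds + k))"

(* The linear extension of x |-> (-1)^(k * |x|) x from homogeneous to arbitrary elements:
   the sign a map of degree k picks up when it passes x. *)
definition koszul_twist :: "(int \<Rightarrow> 'x set) \<Rightarrow> int \<Rightarrow> 'x::ab_group_add \<Rightarrow> 'x" where
  "koszul_twist gr k x =
     (\<Sum>d | component gr x d \<noteq> 0. if even (k * d) then component gr x d else - component gr x d)"

(* The list of tensor factors of (f1 \<otimes> ... \<otimes> fk)(x1 \<otimes> ... \<otimes> xn), with the sign of the Koszul rule
   absorbed into them. Each fj is given as (arity, degree, function on lists); the inputs of fj are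
   passed by all the maps to the right of fj. *)
fun koszul_tensor ::
    "(int \<Rightarrow> 'x set) \<Rightarrow> (nat \<times> int \<times> ('x::ab_group_add list \<Rightarrow> 'y)) list \<Rightarrow> 'x list \<Rightarrow> 'y list" where
  "koszul_tensor gr [] xs = []"
| "koszul_tensor gr ((a, k, f) # fs) xs =
     f (map (koszul_twist gr (\<Sum>(_, k', _)\<leftarrow>fs. k')) (take a xs)) # koszul_tensor gr fs (drop a xs)"

definition stasheff_term ::
    "(int \<Rightarrow> 'x set) \<Rightarrow> (nat \<Rightarrow> 'x list \<Rightarrow> 'x::ab_group_add) \<Rightarrow> nat \<Rightarrow> nat \<Rightarrow> nat \<Rightarrow> 'x list \<Rightarrow> 'x" where
  "stasheff_term gr m r s t xs =
     m (r + 1 + t)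
       (koszul_tensor gr
          (replicate r (1, 0, hd) @ [(s, int s - 2, m s)] @ replicate t (1, 0, hd)) xs)"

locale a_infinity_algebra = chain_complex scale gr bd
  for scale :: "'r::comm_ring_1 \<Rightarrow> 'x::ab_group_add \<Rightarrow> 'x" and gr :: "int \<Rightarrow> 'x set"
    and bd :: "'x \<Rightarrow> 'x" +
  fixes m :: "nat \<Rightarrow> 'x list \<Rightarrow> 'x"
  assumes m_multilinear: "n \<ge> 1 \<Longrightarrow> multilinear scale scale n (m n)"
    and m_degree: "n \<ge> 1 \<Longrightarrow> multi_degree gr n (int n - 2) (m n)"
    and m_1: "m 1 [x] = bd x"
    and stasheff: "n \<ge> 1 \<Longrightarrow> length xs = n \<Longrightarrow>
      (\<Sum>(r, s, t) \<in> {(r, s, t). s \<ge> 1 \<and> r + s + t = n}.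
         scale ((-1) ^ (r + s * t)) (stasheff_term gr m r s t xs)) = 0"

(* The sum over j of the images of X \<otimes> ... \<otimes> h(a_j) \<otimes> ... \<otimes> X is the span of all the values of m_n on
   pure tensors of that form. The rule is only required for homogeneous a_j, which is the weakest
   reading; it holds in particular if it is satisfied by all elements. *)
definition generalized_leibniz ::
    "('r::comm_ring_1 \<Rightarrow> 'x::ab_group_add \<Rightarrow> 'x) \<Rightarrow> (int \<Rightarrow> 'x set) \<Rightarrow>
     (nat \<Rightarrow> 'x list \<Rightarrow> 'x) \<Rightarrow> ('x \<Rightarrow> 'x) \<Rightarrow> bool" where
  "generalized_leibniz scale gr m h \<longleftrightarrow>
     (\<forall>n\<ge>2. \<forall>as. length as = n \<longrightarrow> (\<forall>a\<in>set as. homogeneous gr a) \<longrightarrow>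
        h (m n as) \<in> module.span scale
          {m n (xs[j := h (as ! j)]) | xs j. length xs = n \<and> j < n})"


datatype ptree = Leaf | Node "ptree list"

fun leaves :: "ptree \<Rightarrow> nat" where
  "leaves Leaf = 1"
| "leaves (Node Ts) = (\<Sum>T\<leftarrow>Ts. leaves T)"

fun reduced :: "ptree \<Rightarrow> bool" where
  "reduced Leaf = True"
| "reduced (Node Ts) = (length Ts \<ge> 2 \<and> (\<forall>T\<in>set Ts. reduced T))"

definition PT :: "nat \<Rightarrow> ptree set" where
  "PT n = {T. reduced T \<and> leaves T = n}"

abbreviation corolla :: "nat \<Rightarrow> ptree" where
  "corolla n \<equiv> Node (replicate n Leaf)"

(* The degree of \<phi>_T: each internal vertex with k inputs contributes |h| + |m_k|. *)
fun phi_degree :: "ptree \<Rightarrow> int" where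
  "phi_degree Leaf = 0"
| "phi_degree (Node Ts) = 1 + (int (length Ts) - 2) + (\<Sum>T\<leftarrow>Ts. phi_degree T)"

fun phi ::
    "(int \<Rightarrow> 'y set) \<Rightarrow> (nat \<Rightarrow> 'x list \<Rightarrow> 'x) \<Rightarrow> ('y::ab_group_add \<Rightarrow> 'x) \<Rightarrow> ('x \<Rightarrow> 'x) \<Rightarrow>
     ptree \<Rightarrow> 'y list \<Rightarrow> 'x" where
  "phi gY m i h Leaf = (\<lambda>ys. i (hd ys))"
| "phi gY m i h (Node Ts) = (\<lambda>ys.
     h (m (length Ts)
       (koszul_tensor gY (map (\<lambda>T. (leaves T, phi_degree T, phi gY m i h T)) Ts) ys)))"

(* The operation m_T; there is none for the trivial tree. *)
fun tree_op ::
    "(int \<Rightarrow> 'y set) \<Rightarrow> (nat \<Rightarrow> 'x list \<Rightarrow> 'x) \<Rightarrow> ('y::ab_group_add \<Rightarrow> 'x) \<Rightarrow> ('x \<Rightarrow> 'y) \<Rightarrow>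
     ('x \<Rightarrow> 'x) \<Rightarrow> ptree \<Rightarrow> 'y list \<Rightarrow> 'y" where
  "tree_op gY m i p h (Node Ts) ys =
     p (m (length Ts)
       (koszul_tensor gY (map (\<lambda>T. (leaves T, phi_degree T, phi gY m i h T)) Ts) ys))"

definition transferred_op ::
    "('r::comm_ring_1 \<Rightarrow> 'y::ab_group_add \<Rightarrow> 'y) \<Rightarrow> (int \<Rightarrow> 'y set) \<Rightarrow> ('y \<Rightarrow> 'y) \<Rightarrow>
     (nat \<Rightarrow> 'x list \<Rightarrow> 'x) \<Rightarrow> ('y \<Rightarrow> 'x) \<Rightarrow> ('x \<Rightarrow> 'y) \<Rightarrow> ('x \<Rightarrow> 'x) \<Rightarrow>
     (ptree \<Rightarrow> int) \<Rightarrow> nat \<Rightarrow> 'y list \<Rightarrow> 'y" where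
  "transferred_op sY gY dY m i p h \<epsilon> n ys =
     (if n = 1 then dY (hd ys)
      else (\<Sum>T\<in>PT n. sY (of_int (\<epsilon> T)) (tree_op gY m i p h T ys)))"

lemma leaves_pos: "reduced T \<Longrightarrow> leaves T \<ge> 1"
proof (induction T)
  case (Node Ts)
  then obtain T Ts' where "Ts = T # Ts'" by (cases Ts) auto
  moreover have "leaves T \<ge> 1" using Node calculation by simp
  ultimately show ?case by (simp add: trans_le_add1)
qed simp

lemma length_le_leaves: "\<forall>T\<in>set Ts. reduced T \<Longrightarrow> length Ts \<le> (\<Sum>T\<leftarrow>Ts. leaves T)"
  by (induction Ts) (use leaves_pos in fastforce)+

lemma leaves_child_less:
  assumes "reduced (Node Ts)" "T \<in> set Ts"
  shows "leaves T < leaves (Node Ts)"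
proof -
  obtain us vs where Ts: "Ts = us @ T # vs" using assms(2) by (meson split_list)
  have "length us + length vs \<ge> 1" using assms(1) Ts by auto
  moreover have "length us \<le> (\<Sum>T\<leftarrow>us. leaves T)" "length vs \<le> (\<Sum>T\<leftarrow>vs. leaves T)"
    using assms(1) Ts by (auto intro: length_le_leaves)
  ultimately have "(\<Sum>T\<leftarrow>us. leaves T) + (\<Sum>T\<leftarrow>vs. leaves T) \<ge> 1" by linarith
  moreover have "leaves (Node Ts) =
      (\<Sum>T\<leftarrow>us. leaves T) + leaves T + (\<Sum>T\<leftarrow>vs. leaves T)"
    by (simp add: Ts)
  ultimately show ?thesis by linarith
qed

(* So the sum over PT n in transferred_op is a genuine finite sum. *)
lemma finite_PT: "finite (PT n)"
proof (induction n rule: less_induct)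
  case (less n)
  have "PT n \<subseteq> insert Leaf (Node ` {Ts. set Ts \<subseteq> (\<Union>k<n. PT k) \<and> length Ts \<le> n})"
  proof
    fix T assume T: "T \<in> PT n"
    show "T \<in> insert Leaf (Node ` {Ts. set Ts \<subseteq> (\<Union>k<n. PT k) \<and> length Ts \<le> n})"
    proof (cases T)
      case (Node Ts)
      have red: "reduced (Node Ts)" and n: "leaves (Node Ts) = n"
        using T Node by (auto simp: PT_def)
      have "set Ts \<subseteq> (\<Union>k<n. PT k)"
        using leaves_child_less[OF red] red n by (fastforce simp: PT_def)
      moreover have "length Ts \<le> n" using length_le_leaves[of Ts] red n by simp
      ultimately show ?thesis using Node by blast
    qed simp
  qed
  moreover have "finite {Ts. set Ts \<subseteq> (\<Union>k<n. PT k) \<and> length Ts \<le> n}"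
    by (rule finite_lists_length_le) (use less in auto)
  ultimately show ?case by (meson finite_imageI finite_insert finite_subset)
qed

end

theory Submission
  imports Defs
begin

text \<open>
  The map \<open>\<phi>\<^sub>S\<close> vanishes for every tree \<open>S\<close> other than the leaf. Since a tree
  that is not a corolla has such an \<open>S\<close> as an input of its root, only the corolla survives in
  the sum over trees. By induction and multilinearity the vanishing reduces to corollas
  with homogeneous inputs: there the generalized Leibniz rule puts
  \<open>h (m\<^sub>n (i y\<^sub>1, \<dots>, i y\<^sub>n))\<close> into the span of values of
  \<open>m\<^sub>n\<close> with some argument \<open>h (i y\<^sub>j) = 0\<close>.
\<close>

lemma length_koszul_tensor [simp]: "length (koszul_tensor gr fs xs) = length fs"
  by (induction gr fs xs rule: koszul_tensor.induct) auto

text \<open>The length hypothesis makes the blocks cut off by \<open>take\<close> fit the arities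
  exactly. So the vanishing factor really receives \<open>a\<close> arguments, and the sign twists,
  being applied entrywise, do not change that number.\<close>

lemma zero_in_koszul_tensor:
  assumes "(a, k, f) \<in> set fs" "\<And>xs. length xs = a \<Longrightarrow> f xs = 0"
    and "length xs = (\<Sum>(a, _)\<leftarrow>fs. a)"
  shows "0 \<in> set (koszul_tensor gr fs xs)"
  using assms by (induction gr fs xs rule: koszul_tensor.induct) auto

context graded_module
begin

lemma homogeneous_decomposition_component: "homogeneous_decomposition gr x (component gr x)"
  unfolding component_def using direct_sum by (rule theI')

lemma koszul_twist_0 [simp]: "koszul_twist gr 0 x = x"
  using homogeneous_decomposition_component[of x]
  by (simp add: koszul_twist_def homogeneous_decomposition_def)

lemma koszul_tensor_replicate_hd:
  assumes "length xs = n"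
  shows "koszul_tensor gr (replicate n (1, 0, \<lambda>xs. f (hd xs))) xs = map f xs"
  using assms
proof (induction n arbitrary: xs)
  case (Suc n)
  then obtain x xs' where xs: "xs = x # xs'" "length xs' = n"
    by (cases xs) auto
  \<comment> \<open>The maps to the right have total degree 0, so the twist of the first entry is
    the identity by \<open>koszul_twist_0\<close>.\<close>
  have "(\<Sum>(_, k', _)\<leftarrow>replicate n (1::nat, 0::int, \<lambda>xs. f (hd xs)). k') = 0"
    by (induction n) auto
  then show ?case using xs Suc.IH by simp
qed simp

text \<open>Each argument is a finite sum of homogeneous components, so multilinearity expands the
  value into values on homogeneous arguments. This bridges the gap to the Leibniz rule, which is
  assumed for homogeneous elements only.\<close>

lemma multilinear_eq_0:
  assumes g: "multilinear scale sZ n g"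
    and hom: "\<And>xs. length xs = n \<Longrightarrow> \<forall>x\<in>set xs. homogeneous gr x \<Longrightarrow> g xs = 0"
    and "length xs = n"
  shows "g xs = 0"
proof -
  \<comment> \<open>Only the first \<open>k\<close> entries may be inhomogeneous:
    \<open>k = 0\<close> is the hypothesis \<open>hom\<close>, and \<open>k = n\<close> is the
    claim.\<close>
  have "g xs = 0" if "k \<le> n" "length xs = n" "\<forall>j<n. k \<le> j \<longrightarrow> homogeneous gr (xs ! j)" for k xs
    using that
  proof (induction k arbitrary: xs)
    case 0
    then show ?case by (intro hom) (auto simp: in_set_conv_nth)
  next
    case (Suc k)
    let ?c = "component gr (xs ! k)"
    interpret g: module_hom scale sZ "\<lambda>x. g (xs[k := x])"
      using g Suc.prems unfolding multilinear_def by auto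
    have c: "\<forall>d. ?c d \<in> gr d" "xs ! k = (\<Sum>d | ?c d \<noteq> 0. ?c d)"
      using homogeneous_decomposition_component[of "xs ! k"]
      by (simp_all add: homogeneous_decomposition_def)
    \<comment> \<open>With a component in position \<open>k\<close>, all entries from
      \<open>k\<close> on are homogeneous.\<close>
    have "g (xs[k := ?c d]) = 0" for d
    proof (rule Suc.IH)
      show "\<forall>j<n. k \<le> j \<longrightarrow> homogeneous gr (xs[k := ?c d] ! j)"
        using Suc.prems c(1) by (auto simp: nth_list_update homogeneous_def)
    qed (use Suc.prems in auto)
    then have "g (xs[k := (\<Sum>d | ?c d \<noteq> 0. ?c d)]) = 0"
      by (simp add: g.sum)
    then show ?case
      by (simp add: c(2)[symmetric])
  qed
  from this[of n xs] show ?thesis using assms(3) by simp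
qed

end

lemma multilinear_zero_arg:
  assumes "multilinear sX sY n f" "length xs = n" "0 \<in> set xs"
  shows "f xs = 0"
proof -
  obtain j where j: "j < n" "xs ! j = 0"
    using assms(2,3) by (auto simp: in_set_conv_nth)
  interpret module_hom sX sY "\<lambda>x. f (xs[j := x])"
    using assms j unfolding multilinear_def by auto
  show ?thesis using zero j by (metis list_update_id)
qed

lemma multilinear_compose:
  fixes u :: "'y::ab_group_add \<Rightarrow> 'x::ab_group_add"
  assumes f: "multilinear sX sX' n f" and u: "module_hom sY sX u" and v: "module_hom sX' sZ v"
  shows "multilinear sY sZ n (\<lambda>ys. v (f (map u ys)))"
  unfolding multilinear_def
proof (intro allI impI)
  fix ys :: "'y list" and j
  assume "length ys = n" "j < n"
  then have "module_hom sX sX' (\<lambda>x. f ((map u ys)[j := x]))"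
    using f unfolding multilinear_def by simp
  from module_hom_compose[OF module_hom_compose[OF u this] v]
  show "module_hom sY sZ (\<lambda>y. v (f (map u (ys[j := y]))))"
    by (simp add: map_update o_def)
qed

lemma homotopy_corolla_eq_0:
  fixes i :: "'y::ab_group_add \<Rightarrow> 'x::ab_group_add"
  assumes X: "a_infinity_algebra sX gX dX mX" and Y: "graded_module sY gY"
    and i: "graded_map sY gY sX gX 0 i" and h: "module_hom sX sX h"
    and leibniz: "generalized_leibniz sX gX mX h"
    and h_i: "\<forall>y. h (i y) = 0"
    and n: "n \<ge> 2" "length ys = n"
  shows "h (mX n (map i ys)) = 0"
proof -
  interpret X: a_infinity_algebra sX gX dX mX by (rule X)
  interpret Y: graded_module sY gY by (rule Y)
  have ml: "multilinear sX sX n (mX n)" using X.m_multilinear n by simp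
  have "module_hom sY sX i" using i by (simp add: graded_map_def)
  from multilinear_compose[OF ml this h]
  show ?thesis
  \<comment> \<open>The composite of \<open>h\<close>, \<open>mX n\<close> and \<open>i\<close> in
    every argument is multilinear, so homogeneous \<open>ys\<close> suffice. Their images under
    \<open>i\<close> are homogeneous because \<open>i\<close> has degree 0.\<close>
  proof (rule Y.multilinear_eq_0)
    fix ys :: "'y list"
    assume ys: "length ys = n" "\<forall>y\<in>set ys. homogeneous gY y"
    let ?S = "{mX n (xs[j := h (map i ys ! j)]) | xs j. length xs = n \<and> j < n}"
    have "\<forall>a\<in>set (map i ys). homogeneous gX a"
      using ys(2) i by (fastforce simp: homogeneous_def graded_map_def)
    then have "h (mX n (map i ys)) \<in> X.span ?S"
      using leibniz n ys unfolding generalized_leibniz_def by auto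
    \<comment> \<open>Entry \<open>j\<close> of the updated list is \<open>h (i (ys ! j))\<close>,
      hence 0. So every generator vanishes and the span is the zero submodule.\<close>
    moreover have "mX n (xs[j := h (map i ys ! j)]) = 0" if "length xs = n" "j < n" for xs j
      using that ys h_i by (intro multilinear_zero_arg[OF ml]) (simp_all add: set_update_memI)
    then have "?S \<subseteq> {0}" by blast
    then have "X.span ?S \<subseteq> {0}"
      by (rule X.span_minimal) (rule X.subspace_single_0)
    ultimately show "h (mX n (map i ys)) = 0" by blast
  qed (use n in simp)
qed

text \<open>Each leaf counts once, so the number of inputs is the number of leaves. Read
  contrapositively, this supplies a nontrivial input of the root of any node that is not a
  corolla.\<close>

lemma children_replicate_Leaf:
  assumes "\<forall>T\<in>set Ts. T = Leaf"
  shows "Node Ts = corolla (leaves (Node Ts))"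
proof -
  obtain k where k: "Ts = replicate k Leaf"
    using assms by (metis replicate_length_same)
  have "(\<Sum>T\<leftarrow>replicate k Leaf. leaves T) = k" by (induction k) auto
  with k show ?thesis by simp
qed

context graded_module
begin

lemma koszul_tensor_corolla:
  assumes "length ys = n"
  shows "koszul_tensor gr (map (\<lambda>T. (leaves T, phi_degree T, phi gr m i h T)) (replicate n Leaf)) ys
    = map i ys"
  using koszul_tensor_replicate_hd[OF assms] by (simp add: map_replicate)

end

text \<open>The expression is the common part of \<open>phi\<close> and \<open>tree_op\<close> at a
  node, before \<open>h\<close> or \<open>p\<close> is applied. The vanishing input \<open>T\<close>
  puts a zero among the arguments of the root operation.\<close>

lemma multilinear_koszul_tensor_eq_0:
  assumes m: "multilinear sX sZ (length Ts) (m (length Ts))"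
    and T: "T \<in> set Ts" "\<And>zs. length zs = leaves T \<Longrightarrow> phi gY m i h T zs = 0"
    and ys: "length ys = leaves (Node Ts)"
  shows "m (length Ts)
    (koszul_tensor gY (map (\<lambda>T. (leaves T, phi_degree T, phi gY m i h T)) Ts) ys) = 0"
proof (rule multilinear_zero_arg[OF m])
  show "0 \<in> set (koszul_tensor gY (map (\<lambda>T. (leaves T, phi_degree T, phi gY m i h T)) Ts) ys)"
    using T ys
    by (intro zero_in_koszul_tensor[of "leaves T" "phi_degree T" "phi gY m i h T"]) (auto simp: o_def)
qed simp

lemma phi_eq_0:
  assumes X: "a_infinity_algebra sX gX dX mX" and Y: "graded_module sY gY"
    and i: "graded_map sY gY sX gX 0 i" and h: "module_hom sX sX h"
    and leibniz: "generalized_leibniz sX gX mX h"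
    and h_i: "\<forall>y. h (i y) = 0"
    and T: "reduced T" "T \<noteq> Leaf" "length ys = leaves T"
  shows "phi gY mX i h T ys = 0"
  using T
proof (induction T arbitrary: ys)
  case (Node Ts)
  interpret X: a_infinity_algebra sX gX dX mX by (rule X)
  interpret Y: graded_module sY gY by (rule Y)
  interpret h: module_hom sX sX h by (rule h)
  have len: "length Ts \<ge> 2" using Node.prems by simp
  show ?case
  \<comment> \<open>A leaf contributes \<open>i\<close>, which need not vanish, so the induction
    hypothesis helps only if some input is not a leaf. Otherwise the tree is a corolla, and the
    Leibniz rule applies.\<close>
  proof (cases "\<forall>T\<in>set Ts. T = Leaf")
    case True
    let ?n = "leaves (Node Ts)"
    have Ts: "Ts = replicate ?n Leaf"
      using children_replicate_Leaf[OF True] by simp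
    then have "?n \<ge> 2" using len by (metis length_replicate)
    have "phi gY mX i h (Node Ts) ys = phi gY mX i h (corolla ?n) ys"
      using children_replicate_Leaf[OF True] by (rule arg_cong)
    also have "\<dots> = h (mX ?n (map i ys))"
      using Y.koszul_tensor_corolla[OF Node.prems(3), where i = i] by simp
    also have "\<dots> = 0"
      using homotopy_corolla_eq_0[OF X Y i h leibniz h_i \<open>?n \<ge> 2\<close> Node.prems(3)] .
    finally show ?thesis .
  next
    case False
    then obtain T where T: "T \<in> set Ts" "T \<noteq> Leaf" by blast
    have "multilinear sX sX (length Ts) (mX (length Ts))"
      using len by (intro X.m_multilinear) simp
    from multilinear_koszul_tensor_eq_0[where m = mX, OF this T(1) _ Node.prems(3)] show ?thesis
      using Node.IH[OF T(1)] Node.prems T by simp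
  qed
qed simp

theorem proposition2p7:
  fixes sX :: "'r::comm_ring_1 \<Rightarrow> 'x::ab_group_add \<Rightarrow> 'x" and gX :: "int \<Rightarrow> 'x set"
    and dX :: "'x \<Rightarrow> 'x" and mX :: "nat \<Rightarrow> 'x list \<Rightarrow> 'x"
    and sY :: "'r \<Rightarrow> 'y::ab_group_add \<Rightarrow> 'y" and gY :: "int \<Rightarrow> 'y set"
    and dY :: "'y \<Rightarrow> 'y"
    and i :: "'y \<Rightarrow> 'x" and p :: "'x \<Rightarrow> 'y" and h :: "'x \<Rightarrow> 'x"
    and \<epsilon> :: "ptree \<Rightarrow> int"
  assumes X: "a_infinity_algebra sX gX dX mX"
    and retract: "deformation_retract sX gX dX sY gY dY i p h"
    and signs: "\<forall>T. \<epsilon> T \<in> {1, -1}"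
    and sign_corolla: "\<forall>n\<ge>2. \<epsilon> (corolla n) = 1"
    and setting: "((\<forall>a::'r. a \<noteq> 0 \<longrightarrow> a dvd 1) \<and> CHAR('r) = 0) \<or>
      a_infinity_algebra sY gY dY (transferred_op sY gY dY mX i p h \<epsilon>)"
    and leibniz: "generalized_leibniz sX gX mX h"
    and h_i: "\<forall>y. h (i y) = 0"
  shows "\<forall>n\<ge>1. \<forall>ys. length ys = n \<longrightarrow>
    transferred_op sY gY dY mX i p h \<epsilon> n ys = p (mX n (map i ys))"
proof (intro allI impI)
  fix n and ys :: "'y list"
  assume n: "n \<ge> 1" and ys: "length ys = n"
  interpret X: a_infinity_algebra sX gX dX mX by (rule X)
  interpret D: deformation_retract sX gX dX sY gY dY i p h by (rule retract)
  have i: "graded_map sY gY sX gX 0 i" and i_d: "i (dY y) = dX (i y)" for y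
    using D.i_quasi_isomorphism by (auto simp: quasi_isomorphism_def chain_map_def)
  interpret p: module_hom sX sY p
    using D.p_quasi_isomorphism by (simp add: quasi_isomorphism_def chain_map_def graded_map_def)
  interpret h: module_hom sX sX h
    using D.h_graded by (simp add: graded_map_def)

  show "transferred_op sY gY dY mX i p h \<epsilon> n ys = p (mX n (map i ys))"
  proof (cases "n = 1")
    case True
    then obtain y where "ys = [y]" using ys by (auto simp: length_Suc_conv)
    \<comment> \<open>Since \<open>i\<close> is a chain map,
      \<open>p (dX (i y)) = p (i (dY y))\<close>, and this is \<open>dY y\<close> because
      \<open>p\<close> is a left inverse of \<open>i\<close>.\<close>
    then show ?thesis
      using True X.m_1[of "i y"] by (simp add: transferred_op_def flip: i_d) (simp add: D.p_i)
  next
    case False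
    then have n2: "n \<ge> 2" using n by simp
    have "tree_op gY mX i p h T ys = 0" if T: "T \<in> PT n - {corolla n}" for T
    proof -
      \<comment> \<open>The trivial tree is excluded because it has one leaf and \<open>n\<close> is
        not 1.\<close>
      obtain Ts where Ts: "T = Node Ts" "reduced (Node Ts)" "leaves (Node Ts) = n"
        using T False by (cases T) (auto simp: PT_def)
      then obtain S where S: "S \<in> set Ts" "S \<noteq> Leaf"
        using T children_replicate_Leaf[of Ts] by (metis Diff_iff singletonI)
      have ml: "multilinear sX sX (length Ts) (mX (length Ts))"
        using Ts by (intro X.m_multilinear) simp
      have "phi gY mX i h S zs = 0" if "length zs = leaves S" for zs
        using phi_eq_0[OF X D.Y.graded_module_axioms i h.module_hom_axioms leibniz h_i _ S(2) that]
          S(1) Ts(2) by simp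
      then show ?thesis
        using multilinear_koszul_tensor_eq_0[where m = mX and i = i and ys = ys, OF ml S(1)] Ts ys
        by (simp add: p.zero)
    qed
    moreover have "corolla n \<in> PT n"
      using n2 by (simp add: PT_def sum_list_replicate)
    \<comment> \<open>Finiteness of \<open>PT n\<close> allows splitting off the corolla; every
      other summand is 0, whatever its sign.\<close>
    ultimately have "(\<Sum>T\<in>PT n. sY (of_int (\<epsilon> T)) (tree_op gY mX i p h T ys)) =
        sY (of_int (\<epsilon> (corolla n))) (tree_op gY mX i p h (corolla n) ys)"
      by (simp add: sum.remove[OF finite_PT])
    also have "\<dots> = p (mX n (map i ys))"
      using sign_corolla n2 D.Y.koszul_tensor_corolla[OF ys, where i = i] by simp
    finally show ?thesis using False by (simp add: transferred_op_def)
  qed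
qed

end
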